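(* Let $n \geq 1$ be an integer and let $K$ and $\tilde{K}$ be $n \times n$ real matrices with nonnegative entries. The following are equivalent: (i) The functions $R_e[K]$ and $R_e[\tilde{K}]$ coincide on $\mathbb{R}_+^n$. (ii) The functions $R_e[K]$ and $R_e[\tilde{K}]$ coincide on $\{0,1\}^n$. (iii) The functions $\mathrm{Spec}[K]$ and $\mathrm{Spec}[\tilde{K}]$ coincide on $\mathbb{R}_+^n$. (iv) The functions $\mathrm{Spec}[K]$ and $\mathrm{Spec}[\tilde{K}]$ coincide on $\{0,1\}^n$. (v) All principal minors of $K$ and $\tilde{K}$ coincide, that is, $\det(K[\alpha]) = \det(\tilde{K}[\alpha])$ for every non-empty $\alpha \subset \{1,\ldots,n\}$.
   Context: Here $\mathbb{R}_+ = [0,\infty)$. For a square matrix $M$, $\mathrm{spec}(M)$ denotes its spectrum (set of complex eigenvalues) and $\rho(M) = \max\{|\lambda| : \lambda \in \mathrm{spec}(M)\}$ its spectral radius. For $\eta \in \mathbb{R}_+^n$, $\mathrm{Diag}(\eta)$ is the $n\times n$ diagonal matrix with diagonal entries given by $\eta$. For an $n \times n$ matrix $K$, the effective spectrum function $\mathrm{Spec}[K]$ and the effective spectral radius function $R_e[K]$ are defined on $\mathbb{R}_+^n$ by $\mathrm{Spec}[K](\eta) = \mathrm{spec}(K \cdot \mathrm{Diag}(\eta))$ and $R_e[K](\eta) = \rho(K \cdot \mathrm{Diag}(\eta))$. For a non-empty subset $\alpha$ of $\{1,\ldots,n\}$, $K[\alpha]$ denotes the submatrix of $K$ obtained by keeping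 the rows and columns with indices in $\alpha$; its determinant is called a principal minor of $K$. *)

theory Defs
  imports
    "Jordan_Normal_Form.Spectral_Radius"
    "Jordan_Normal_Form.DL_Submatrix"
begin

text \<open>Matrices and vectors are zero-based, so indices range over
  \<open>{0..<n}\<close> instead of \<open>{1,\<dots>,n}\<close>.\<close>

definition nonneg_vecs :: "nat \<Rightarrow> real vec set" where
  "nonneg_vecs n = {\<eta> \<in> carrier_vec n. \<forall>i<n. 0 \<le> \<eta> $ i}"

definition zero_one_vecs :: "nat \<Rightarrow> real vec set" where
  "zero_one_vecs n = {\<eta> \<in> carrier_vec n. \<forall>i<n. \<eta> $ i \<in> {0, 1}}"

definition Diag :: "real vec \<Rightarrow> real mat" where
  "Diag \<eta> = mat_diag (dim_vec \<eta>) (\<lambda>i. \<eta> $ i)"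

text \<open>The spectrum of a real matrix is its set of complex eigenvalues (without
  multiplicities), hence the embedding into complex matrices.\<close>

definition eff_spectrum :: "real mat \<Rightarrow> real vec \<Rightarrow> complex set" where
  "eff_spectrum K \<eta> = spectrum (map_mat complex_of_real (K * Diag \<eta>))"

definition eff_spectral_radius :: "real mat \<Rightarrow> real vec \<Rightarrow> real" where
  "eff_spectral_radius K \<eta> = spectral_radius (map_mat complex_of_real (K * Diag \<eta>))"

definition principal_minor :: "real mat \<Rightarrow> nat set \<Rightarrow> real" where
  "principal_minor K \<alpha> = Determinant.det (submatrix K \<alpha> \<alpha>)"

end

theory Submission
  imports Defs
begin

text \<open>Write \<open>m\<^sub>S\<close> for the principal minor of \<open>K\<close> with index set \<open>S\<close>. Two facts carry the proof.

  First, the characteristic polynomial of \<open>K * Diag \<eta>\<close> is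
  \<open>\<Sum>S. (-1)^|S| m\<^sub>S (\<Prod>i\<in>S. \<eta> i) x^(n - |S|)\<close>
  (\<open>poly_char_poly_mult_Diag\<close>). Hence equal principal minors give equal spectra for all \<open>\<eta>\<close>, and
  equal spectra give equal spectral radii. Each of the conditions on spectra or radii contains the
  equality of the radii on 0-1 vectors, so it remains to recover the minors from these radii.

  Second, the spectral radius of a nonnegative matrix is one of its eigenvalues
  (\<open>spectral_radius_in_spectrum_nonneg\<close>). This is what makes the recovery possible. Take \<open>\<eta>\<close> to be the
  indicator vector of \<open>S\<close>. Only the minors with index set inside \<open>S\<close> survive in the expansion, so if
  the minors of \<open>K\<close> and \<open>K'\<close> agree for the proper subsets of \<open>S\<close>, the two characteristic
  polynomials differ only by \<open>\<plusminus>(m\<^sub>S - m'\<^sub>S) x^(n - |S|)\<close>. They have the common spectral radius as a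
  common root, which forces \<open>m\<^sub>S = m'\<^sub>S\<close> if that root is nonzero; if it is zero, both polynomials are
  \<open>x^n\<close> and again \<open>m\<^sub>S = m'\<^sub>S\<close>. Induction on \<open>S\<close> finishes the argument.

  The eigenvalue property is obtained from traces. The power sums of the eigenvalues are the traces of the
  powers of the matrix, hence nonnegative. So the rational function
  \<open>\<Sum>\<^sub>i 1 / (1 - d\<^sub>i w)\<close>, where \<open>d\<^sub>i\<close> runs through the eigenvalues, has nonnegative Taylor coefficients,
  and for \<open>|w|\<close> below the radius of convergence its modulus at \<open>w\<close> is at most its value at \<open>|w|\<close>. Approaching the pole that belongs to an eigenvalue of
  maximal modulus \<open>r > 0\<close>, one sees that \<open>1/r\<close> must be a pole too.\<close>

section \<open>Principal minors and the characteristic polynomial\<close>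

text \<open>A principal minor written as a Leibniz sum over the permutations of the index set itself.
  Keeping the original indices makes the expansion of a larger determinant into such terms direct,
  without renumbering rows and columns; the renumbering is done once, in \<open>det_principal_submatrix\<close>.\<close>

definition leibniz_minor :: "'a :: comm_ring_1 mat \<Rightarrow> nat set \<Rightarrow> 'a" where
  "leibniz_minor A S = (\<Sum>p | p permutes S. of_int (sign p) * (\<Prod>i\<in>S. A $$ (i, p i)))"

lemma bij_betw_pick:
  assumes "finite S"
  shows "bij_betw (pick S) {0..<card S} S"
proof -
  have "inj_on (pick S) {0..<card S}"
    by (rule strict_mono_on_imp_inj_on) (auto simp: strict_mono_on_def intro: pick_mono)
  moreover have "pick S ` {0..<card S} \<subseteq> S"
    using assms pick_in_set_le by auto
  ultimately show ?thesis
    using assms by (metis bij_betw_def card_atLeastLessThan card_image card_subset_eq diff_zero)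
qed

text \<open>Conjugation with the increasing enumeration of \<open>S\<close> carries the permutations of
  \<open>{0..<|S|}\<close> to those of \<open>S\<close> and preserves signs.\<close>

lemma det_principal_submatrix:
  assumes A: "A \<in> carrier_mat n n" and S: "S \<subseteq> {0..<n}"
  shows "Determinant.det (submatrix A S S) = leibniz_minor A S"
proof -
  define N where "N = {0..<card S}"
  define f where "f = pick S"
  define g where "g = inv_into N f"
  have fin: "finite S" using S finite_subset by blast
  have f: "bij_betw f N S" unfolding f_def N_def by (rule bij_betw_pick[OF fin])
  have g: "bij_betw g S N" unfolding g_def using f by (rule bij_betw_inv_into)
  have fg: "\<And>x. x \<in> S \<Longrightarrow> f (g x) = x" and gf: "\<And>x. x \<in> N \<Longrightarrow> g (f x) = x"
    using f unfolding g_def by (auto simp: bij_betw_inv_into_left bij_betw_inv_into_right)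
  have SS: "{i. i < n \<and> i \<in> S} = S" using S by auto
  have carr: "submatrix A S S \<in> carrier_mat (card S) (card S)"
    using A SS by (intro carrier_matI) (auto simp: dim_submatrix)
  have idx: "submatrix A S S $$ (i, j) = A $$ (f i, f j)" if "i \<in> N" "j \<in> N" for i j
    using that A unfolding f_def N_def by (subst submatrix_index) (auto simp: SS)
  have "Determinant.det (submatrix A S S)
      = (\<Sum>p | p permutes N. of_int (sign p) * (\<Prod>i\<in>N. submatrix A S S $$ (i, p i)))"
    unfolding det_def'[OF carr] N_def ..
  also have "\<dots> = leibniz_minor A S" unfolding leibniz_minor_def
  proof (rule sum.reindex_bij_witness[of _ "map_permutation S g" "map_permutation N f"])
    fix p assume "p \<in> {p. p permutes N}"
    then have p: "p permutes N" by simp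
    show "map_permutation S g (map_permutation N f p) = p"
      by (rule map_permutation_compose_inv[OF f p]) (simp add: gf)
    show "map_permutation N f p \<in> {p. p permutes S}"
      using map_permutation_permutes[OF f p] by simp
    have "(\<Prod>i\<in>S. A $$ (i, map_permutation N f p i)) = (\<Prod>i\<in>N. A $$ (f i, map_permutation N f p (f i)))"
      by (rule prod.reindex_bij_betw[OF f, symmetric])
    also have "\<dots> = (\<Prod>i\<in>N. submatrix A S S $$ (i, p i))"
      using f p by (intro prod.cong refl)
        (simp add: map_permutation_apply idx bij_betw_def permutes_in_image)
    finally show "of_int (sign (map_permutation N f p)) * (\<Prod>i\<in>S. A $$ (i, map_permutation N f p i))
        = of_int (sign p) * (\<Prod>i\<in>N. submatrix A S S $$ (i, p i))"
      using f p by (simp add: sign_map_permutation bij_betw_def N_def)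
  next
    fix p assume "p \<in> {p. p permutes S}"
    then have p: "p permutes S" by simp
    show "map_permutation N f (map_permutation S g p) = p"
      by (rule map_permutation_compose_inv[OF g p]) (simp add: fg)
    show "map_permutation S g p \<in> {p. p permutes N}"
      using map_permutation_permutes[OF g p] by simp
  qed
  finally show ?thesis .
qed

text \<open>Multiplying out each product in the Leibniz formula for \<open>x I - A\<close> picks a set \<open>S\<close> of rows from which
  the entry of \<open>A\<close> is taken. The remaining rows contribute diagonal entries of \<open>x I\<close>, so
  only the permutations that fix them survive, and these are the permutations of \<open>S\<close>.\<close>

lemma poly_char_poly_eq_sum_minors:
  fixes A :: "'a :: comm_ring_1 mat"
  assumes A: "A \<in> carrier_mat n n"
  shows "poly (char_poly A) x
    = (\<Sum>S\<in>Pow {0..<n}. (-1) ^ card S * leibniz_minor A S * x ^ (n - card S))"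
proof -
  define M where "M = Matrix.mat n n (\<lambda>(i, j). (if i = j then x else 0) - A $$ (i, j))"
  let ?N = "{0..<n}"
  have "poly (char_poly A) x = Determinant.det M"
    unfolding char_poly_def
    by (rule poly_det_cong[of _ n]) (use A in \<open>auto simp: M_def char_poly_matrix_def\<close>)
  also have "\<dots> = (\<Sum>p | p permutes ?N. of_int (sign p) * (\<Prod>i\<in>?N. (if i = p i then x else 0) - A $$ (i, p i)))"
    by (subst det_def'[of _ n]) (auto simp: M_def permutes_in_image intro!: sum.cong prod.cong)
  also have "\<dots> = (\<Sum>p | p permutes ?N. \<Sum>S\<in>Pow ?N. of_int (sign p) *
      ((-1) ^ card S * (\<Prod>i\<in>S. A $$ (i, p i)) * (\<Prod>i\<in>?N - S. if i = p i then x else 0)))"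
    by (simp add: prod_diff_conv_sum sum_distrib_left)
  also have "\<dots> = (\<Sum>S\<in>Pow ?N. \<Sum>p | p permutes ?N. of_int (sign p) *
      ((-1) ^ card S * (\<Prod>i\<in>S. A $$ (i, p i)) * (\<Prod>i\<in>?N - S. if i = p i then x else 0)))"
    by (rule sum.swap)
  also have "\<dots> = (\<Sum>S\<in>Pow ?N. (-1) ^ card S * leibniz_minor A S * x ^ (n - card S))"
  proof (rule sum.cong[OF refl])
    fix S assume "S \<in> Pow ?N"
    then have S: "S \<subseteq> ?N" and fin: "finite S" using finite_subset by auto
    let ?t = "\<lambda>p. of_int (sign p) *
      ((-1) ^ card S * (\<Prod>i\<in>S. A $$ (i, p i)) * (\<Prod>i\<in>?N - S. if i = p i then x else 0))"
    have "(\<Sum>p | p permutes ?N. ?t p) = (\<Sum>p | p permutes S. ?t p)"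
    proof (rule sum.mono_neutral_right)
      show "finite {p. p permutes ?N}" by (simp add: finite_permutations)
      show "{p. p permutes S} \<subseteq> {p. p permutes ?N}" using S permutes_subset by blast
      show "\<forall>p\<in>{p. p permutes ?N} - {p. p permutes S}. ?t p = 0"
      proof
        fix p assume p: "p \<in> {p. p permutes ?N} - {p. p permutes S}"
        then obtain i where "i \<in> ?N - S" "p i \<noteq> i"
          using permutes_superset[of p ?N S] by auto
        then have "(\<Prod>i\<in>?N - S. if i = p i then x else 0) = 0"
          by (intro prod_zero) (auto intro!: bexI[of _ i])
        then show "?t p = 0" by simp
      qed
    qed
    also have "\<dots> = (\<Sum>p | p permutes S. (-1) ^ card S * (of_int (sign p) * (\<Prod>i\<in>S. A $$ (i, p i))) * x ^ (n - card S))"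
    proof (rule sum.cong[OF refl])
      fix p assume p: "p \<in> {p. p permutes S}"
      have "(\<Prod>i\<in>?N - S. if i = p i then x else 0) = (\<Prod>i\<in>?N - S. x)"
        using p by (intro prod.cong) (auto simp: permutes_not_in)
      also have "\<dots> = x ^ (n - card S)" using S fin by (simp add: card_Diff_subset)
      finally show "?t p = (-1) ^ card S * (of_int (sign p) * (\<Prod>i\<in>S. A $$ (i, p i))) * x ^ (n - card S)"
        by (simp add: mult_ac)
    qed
    also have "\<dots> = (-1) ^ card S * leibniz_minor A S * x ^ (n - card S)"
      unfolding leibniz_minor_def by (simp add: sum_distrib_left sum_distrib_right)
    finally show "(\<Sum>p | p permutes ?N. ?t p) = (-1) ^ card S * leibniz_minor A S * x ^ (n - card S)" .
  qed
  finally show ?thesis .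
qed

text \<open>Right multiplication by a diagonal matrix scales columns. Since a permutation of \<open>S\<close>
  uses every column in \<open>S\<close> exactly once, all terms of the Leibniz sum acquire the same factor.\<close>

lemma leibniz_minor_mult_Diag:
  assumes K: "K \<in> carrier_mat n n" and \<eta>: "\<eta> \<in> carrier_vec n" and S: "S \<subseteq> {0..<n}"
  shows "leibniz_minor (map_mat complex_of_real (K * Diag \<eta>)) S
    = complex_of_real (leibniz_minor K S * (\<Prod>i\<in>S. \<eta> $ i))"
proof -
  have "(\<Prod>i\<in>S. map_mat complex_of_real (K * Diag \<eta>) $$ (i, p i))
    = complex_of_real ((\<Prod>i\<in>S. K $$ (i, p i)) * (\<Prod>i\<in>S. \<eta> $ i))" if p: "p permutes S" for p
  proof -
    have "(\<Prod>i\<in>S. map_mat complex_of_real (K * Diag \<eta>) $$ (i, p i))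
      = (\<Prod>i\<in>S. complex_of_real (K $$ (i, p i) * \<eta> $ p i))"
    proof (rule prod.cong[OF refl])
      fix i assume "i \<in> S"
      then have "i < n" "p i < n" using S p permutes_in_image[OF p, of i] by auto
      then show "map_mat complex_of_real (K * Diag \<eta>) $$ (i, p i) = complex_of_real (K $$ (i, p i) * \<eta> $ p i)"
        using K \<eta> by (auto simp: Diag_def mat_diag_mult_right[OF K])
    qed
    also have "\<dots> = complex_of_real ((\<Prod>i\<in>S. K $$ (i, p i)) * (\<Prod>i\<in>S. \<eta> $ p i))"
      by (simp add: prod.distrib)
    also have "(\<Prod>i\<in>S. \<eta> $ p i) = (\<Prod>i\<in>S. \<eta> $ i)"
      using prod.permute[OF p, of "\<lambda>i. \<eta> $ i"] by (simp add: o_def)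
    finally show ?thesis .
  qed
  then have "leibniz_minor (map_mat complex_of_real (K * Diag \<eta>)) S
    = (\<Sum>p | p permutes S. of_int (sign p) * complex_of_real ((\<Prod>i\<in>S. K $$ (i, p i)) * (\<Prod>i\<in>S. \<eta> $ i)))"
    unfolding leibniz_minor_def by (intro sum.cong) auto
  then show ?thesis unfolding leibniz_minor_def by (simp add: sum_distrib_right mult.assoc)
qed

section \<open>The spectral radius of a nonnegative matrix is an eigenvalue\<close>

text \<open>A finite form of Pringsheim's theorem: a power series with nonnegative coefficients is
  singular at the positive point of its circle of convergence. Here the series is
  \<open>\<Sum>k. t k w^k = \<Sum>\<^sub>i 1 / (1 - d\<^sub>i w)\<close>. Multiplied by \<open>1 - x\<close>, its value at
  \<open>w = x / \<mu>\<close> tends to the number of indices with \<open>d\<^sub>i = \<mu>\<close> as \<open>x\<close> tends to \<open>1\<close>.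
  For \<open>d j\<close> nonzero, comparing \<open>\<mu> = d j\<close> with \<open>\<mu> = |d j|\<close> shows that \<open>|d j|\<close> occurs at least as often as \<open>d j\<close>.\<close>

lemma max_modulus_occurs_if_power_sums_nonneg:
  fixes d :: "'i \<Rightarrow> complex" and t :: "nat \<Rightarrow> real"
  assumes I: "finite I" and j: "j \<in> I"
    and dom: "\<And>i. i \<in> I \<Longrightarrow> norm (d i) \<le> norm (d j)"
    and power_sums: "\<And>k. (\<Sum>i\<in>I. d i ^ k) = of_real (t k)" and nonneg: "\<And>k. 0 \<le> t k"
  shows "\<exists>i\<in>I. d i = of_real (norm (d j))"
proof (cases "d j = 0")
  case True
  then show ?thesis using j by auto
next
  case False
  define r where "r = norm (d j)"
  have r: "r > 0" using False by (simp add: r_def)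
  \<comment> \<open>The argument is \<open>x / \<mu>\<close> with real \<open>x\<close> below 1, so that the pole belonging to \<open>\<mu>\<close> is approached radially.\<close>
  define F where "F \<mu> x = (\<Sum>i\<in>I. 1 / (1 - d i / \<mu> * of_real x))" for \<mu> :: complex and x :: real
  have sums: "(\<lambda>k. of_real (t k) * (of_real x / \<mu>) ^ k) sums F \<mu> x"
    if "norm \<mu> = r" "0 < x" "x < 1" for \<mu> x
  proof -
    have "(\<lambda>k. \<Sum>i\<in>I. (d i / \<mu> * of_real x) ^ k) sums F \<mu> x"
      unfolding F_def
    proof (intro sums_sum geometric_sums)
      fix i assume "i \<in> I"
      then have "norm (d i) / r \<le> 1" using dom r by (simp add: r_def)
      then have "norm (d i) / r * x \<le> 1 * x" using that by (intro mult_right_mono) auto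
      also have "\<dots> < 1" using that by simp
      finally show "norm (d i / \<mu> * of_real x) < 1" using that by (simp add: norm_mult norm_divide)
    qed
    also have "(\<lambda>k. \<Sum>i\<in>I. (d i / \<mu> * of_real x) ^ k) = (\<lambda>k. of_real (t k) * (of_real x / \<mu>) ^ k)"
      by (rule ext) (simp add: power_sums[symmetric] sum_distrib_right sum_divide_distrib power_mult_distrib power_divide)
    finally show ?thesis .
  qed
  \<comment> \<open>The only place where the signs of the power sums enter: the value at \<open>x / r\<close> is the sum of the moduli.\<close>
  have bound: "norm (F (d j) x) \<le> norm (F (of_real r) x)" if x: "0 < x" "x < 1" for x
  proof -
    let ?g = "\<lambda>k. t k * (x / r) ^ k"
    have g: "?g sums Re (F (of_real r) x)"
      using sums_Re[OF sums[of "of_real r" x]] x r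
      by (simp flip: of_real_divide of_real_power of_real_mult)
    have "norm (suminf (\<lambda>k. of_real (t k) * (of_real x / d j) ^ k)) \<le> suminf ?g"
      using x by (intro norm_suminf_le)
        (auto simp: norm_mult norm_power norm_divide nonneg r_def intro: sums_summable[OF g, unfolded r_def])
    then have "norm (F (d j) x) \<le> Re (F (of_real r) x)"
      using sums_unique[OF g] sums_unique[OF sums[of "d j" x]] x by (simp add: r_def)
    also have "\<dots> \<le> norm (F (of_real r) x)" by (rule complex_Re_le_cmod)
    finally show ?thesis .
  qed
  have lim: "((\<lambda>x. of_real (1 - x) * F \<mu> x) \<longlongrightarrow> of_nat (card {i\<in>I. d i = \<mu>})) (at_left 1)"
    if "\<mu> \<noteq> 0" for \<mu>
  proof -
    have "((\<lambda>x. of_real (1 - x) / (1 - d i / \<mu> * of_real x)) \<longlongrightarrow> (if d i = \<mu> then 1 else 0)) (at_left (1::real))" for i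
    proof (cases "d i = \<mu>")
      case True
      have "\<forall>\<^sub>F x in at_left (1::real). 1 = complex_of_real (1 - x) / (1 - d i / \<mu> * of_real x)"
        unfolding eventually_at_filter using True that
        by (intro always_eventually) auto
      from Lim_transform_eventually[OF tendsto_const this] show ?thesis using True by simp
    next
      case False
      have "((\<lambda>x. of_real (1 - x) / (1 - d i / \<mu> * of_real x)) \<longlongrightarrow> of_real (1 - 1) / (1 - d i / \<mu> * of_real 1)) (at_left (1::real))"
        using False that by (intro tendsto_intros) auto
      then show ?thesis using False by simp
    qed
    then have "((\<lambda>x. \<Sum>i\<in>I. of_real (1 - x) / (1 - d i / \<mu> * of_real x)) \<longlongrightarrow> (\<Sum>i\<in>I. if d i = \<mu> then 1 else 0)) (at_left (1::real))"
      by (intro tendsto_sum)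
    then show ?thesis
      using I by (simp add: F_def sum_distrib_left sum.If_cases Int_def)
  qed
  have "norm (of_nat (card {i\<in>I. d i = d j}) :: complex) \<le> norm (of_nat (card {i\<in>I. d i = of_real r}) :: complex)"
  proof (rule tendsto_le)
    show "at_left (1::real) \<noteq> bot" by simp
    show "((\<lambda>x. norm (of_real (1 - x) * F (d j) x)) \<longlongrightarrow> norm (of_nat (card {i\<in>I. d i = d j}) :: complex)) (at_left 1)"
      using False by (intro tendsto_norm lim)
    show "((\<lambda>x. norm (of_real (1 - x) * F (of_real r) x)) \<longlongrightarrow> norm (of_nat (card {i\<in>I. d i = of_real r}) :: complex)) (at_left 1)"
      using r by (intro tendsto_norm lim) simp
    have "\<forall>\<^sub>F x in at_left (1::real). x \<in> {0<..<1}"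
      by (rule eventually_at_left_real) simp
    then show "\<forall>\<^sub>F x in at_left 1. norm (of_real (1 - x) * F (d j) x) \<le> norm (of_real (1 - x) * F (of_real r) x)"
      by eventually_elim (auto simp: norm_mult bound intro!: mult_left_mono)
  qed
  moreover have "card {i\<in>I. d i = d j} > 0" using I j by (subst card_gt_0_iff) auto
  ultimately have "card {i\<in>I. d i = of_real r} > 0" by simp
  then show ?thesis unfolding r_def by (auto simp: card_gt_0_iff)
qed

lemma trace_mult_commute:
  fixes A B :: "'a :: comm_semiring_0 mat"
  assumes "A \<in> carrier_mat n n" "B \<in> carrier_mat n n"
  shows "(\<Sum>i<n. (A * B) $$ (i, i)) = (\<Sum>i<n. (B * A) $$ (i, i))"
proof -
  have "(\<Sum>i<n. (A * B) $$ (i, i)) = (\<Sum>i<n. \<Sum>k<n. A $$ (i, k) * B $$ (k, i))"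
    using assms by (intro sum.cong) (auto simp: scalar_prod_def lessThan_atLeast0)
  also have "\<dots> = (\<Sum>k<n. \<Sum>i<n. A $$ (i, k) * B $$ (k, i))" by (rule sum.swap)
  also have "\<dots> = (\<Sum>k<n. (B * A) $$ (k, k))"
    using assms by (intro sum.cong) (auto simp: scalar_prod_def lessThan_atLeast0 mult.commute)
  finally show ?thesis .
qed

lemma upper_triangular_pow:
  fixes B :: "'a :: comm_ring_1 mat"
  assumes B: "B \<in> carrier_mat n n" "upper_triangular B"
  shows "upper_triangular (B ^\<^sub>m k) \<and> (\<forall>i<n. (B ^\<^sub>m k) $$ (i, i) = B $$ (i, i) ^ k)"
proof (induction k)
  case 0
  then show ?case using B by auto
next
  case (Suc k)
  define C where "C = B ^\<^sub>m k"
  have C: "C \<in> carrier_mat n n" using B by (simp add: C_def)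
  have ut: "C $$ (i, l) * B $$ (l, j) = 0" if "l < i \<or> j < l" "i < n" "l < n" "j < n" for i j l
    using that B C Suc unfolding C_def[symmetric]
    by (auto dest: upper_triangularD)
  have entry: "(C * B) $$ (i, j) = (\<Sum>l<n. C $$ (i, l) * B $$ (l, j))" if "i < n" "j < n" for i j
    using that B C by (auto simp: scalar_prod_def lessThan_atLeast0)
  have "(C * B) $$ (i, j) = 0" if "j < i" "i < n" for i j
    unfolding entry[OF that(2) less_trans[OF that]]
    using that by (intro sum.neutral ballI ut) auto
  moreover have "(C * B) $$ (i, i) = C $$ (i, i) * B $$ (i, i)" if i: "i < n" for i
  proof -
    have "(\<Sum>l<n. C $$ (i, l) * B $$ (l, i)) = (\<Sum>l\<in>{i}. C $$ (i, l) * B $$ (l, i))"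
      using i by (intro sum.mono_neutral_right) (auto intro!: ut)
    then show ?thesis using entry[OF i i] by simp
  qed
  ultimately show ?case using Suc B C unfolding C_def[symmetric]
    by (auto simp: C_def[symmetric] mult.commute)
qed

text \<open>Schur decomposition reduces the claim to an upper triangular matrix, whose diagonal carries the
  eigenvalues, with multiplicity, and behaves multiplicatively under powers.\<close>

lemma trace_pow_eq_power_sum:
  fixes A :: "complex mat"
  assumes A: "A \<in> carrier_mat n n"
  obtains d :: "nat \<Rightarrow> complex"
  where "spectrum A = d ` {..<n}" "\<And>k. (\<Sum>i<n. (A ^\<^sub>m k) $$ (i, i)) = (\<Sum>i<n. d i ^ k)"
proof -
  obtain as where "char_poly A = (\<Prod>a\<leftarrow>as. [:- a, 1:])"
    using char_poly_factorized[OF A] by auto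
  from schur_decomposition_exists[OF A this] obtain B where
    B: "B \<in> carrier_mat n n" "upper_triangular B" and sim: "similar_mat A B" by auto
  from sim obtain P Q where wit: "similar_mat_wit A B P Q" unfolding similar_mat_def by auto
  have PQ: "P \<in> carrier_mat n n" "Q \<in> carrier_mat n n" "Q * P = 1\<^sub>m n"
    using similar_mat_witD2[OF A wit] by auto
  show thesis
  proof (rule that[of "\<lambda>i. B $$ (i, i)"])
    have "char_poly A = (\<Prod>a\<leftarrow>diag_mat B. [:- a, 1:])"
      using char_poly_similar[OF sim] char_poly_upper_triangular[OF B] by simp
    then have "spectrum A = set (diag_mat B)"
      unfolding spectrum_root_char_poly[OF A] by (auto simp: poly_prod_list prod_list_zero_iff)
    then show "spectrum A = (\<lambda>i. B $$ (i, i)) ` {..<n}"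
      using B by (auto simp: diag_mat_def)
  next
    fix k
    have Bk: "B ^\<^sub>m k \<in> carrier_mat n n" using B by simp
    have "(\<Sum>i<n. (A ^\<^sub>m k) $$ (i, i)) = (\<Sum>i<n. (P * (B ^\<^sub>m k * Q)) $$ (i, i))"
      using similar_mat_wit_pow_id[OF wit, of k] PQ Bk by (simp add: assoc_mult_mat)
    also have "\<dots> = (\<Sum>i<n. (B ^\<^sub>m k * Q * P) $$ (i, i))"
      using PQ Bk by (intro trace_mult_commute) auto
    also have "B ^\<^sub>m k * Q * P = B ^\<^sub>m k"
      using PQ Bk by (simp add: assoc_mult_mat[of _ n n _ n _ n] right_mult_one_mat[of _ n n])
    also have "(\<Sum>i<n. (B ^\<^sub>m k) $$ (i, i)) = (\<Sum>i<n. B $$ (i, i) ^ k)"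
      using upper_triangular_pow[OF B, of k] by simp
    finally show "(\<Sum>i<n. (A ^\<^sub>m k) $$ (i, i)) = (\<Sum>i<n. B $$ (i, i) ^ k)" .
  qed
qed

lemma nonneg_pow_mat:
  fixes A :: "real mat"
  assumes A: "A \<in> carrier_mat n n" and nonneg: "\<forall>i<n. \<forall>j<n. 0 \<le> A $$ (i, j)"
  shows "\<forall>i<n. \<forall>j<n. 0 \<le> (A ^\<^sub>m k) $$ (i, j)"
proof (induction k)
  case 0
  then show ?case using A by auto
next
  case (Suc k)
  have "A ^\<^sub>m k \<in> carrier_mat n n" using A by simp
  then show ?case using A nonneg Suc
    by (auto simp: scalar_prod_def intro!: sum_nonneg mult_nonneg_nonneg)
qed

text \<open>The weak form of the Perron--Frobenius theorem. Nonnegativity of \<open>A\<close> is used only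
  through the traces of its powers, which are the power sums of the eigenvalues.\<close>

lemma spectral_radius_in_spectrum_nonneg:
  fixes A :: "real mat"
  assumes A: "A \<in> carrier_mat n n" and nonneg: "\<forall>i<n. \<forall>j<n. 0 \<le> A $$ (i, j)" and n: "n > 0"
  defines "C \<equiv> map_mat complex_of_real A"
  shows "complex_of_real (spectral_radius C) \<in> spectrum C"
proof -
  have C: "C \<in> carrier_mat n n" using A by (simp add: C_def)
  obtain d where d: "spectrum C = d ` {..<n}" "\<And>k. (\<Sum>i<n. (C ^\<^sub>m k) $$ (i, i)) = (\<Sum>i<n. d i ^ k)"
    using trace_pow_eq_power_sum[OF C] by metis
  obtain j where j: "j < n" "spectral_radius C = norm (d j)"
    using spectral_radius_mem_max(1)[OF C n] d(1) by auto
  have "\<exists>i\<in>{..<n}. d i = of_real (norm (d j))"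
  proof (rule max_modulus_occurs_if_power_sums_nonneg)
    show "norm (d i) \<le> norm (d j)" if "i \<in> {..<n}" for i
      using spectral_radius_mem_max(2)[OF C n, of "norm (d i)"] d(1) j that by auto
    show "(\<Sum>i<n. d i ^ k) = of_real (\<Sum>i<n. (A ^\<^sub>m k) $$ (i, i))" for k
    proof -
      have "C ^\<^sub>m k = map_mat of_real (A ^\<^sub>m k)"
        unfolding C_def using A by (simp add: of_real_hom.mat_hom_pow)
      then show ?thesis unfolding d(2)[symmetric] using A by simp
    qed
    show "0 \<le> (\<Sum>i<n. (A ^\<^sub>m k) $$ (i, i))" for k
      using nonneg_pow_mat[OF A nonneg, of k] by (intro sum_nonneg) auto
  qed (use j in auto)
  then show ?thesis using d(1) j by force
qed

lemma char_poly_of_spectral_radius_0: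
  fixes A :: "complex mat"
  assumes A: "A \<in> carrier_mat n n" and n: "n > 0" and "spectral_radius A = 0"
  shows "poly (char_poly A) x = x ^ n"
proof -
  obtain as where as: "char_poly A = (\<Prod>a\<leftarrow>as. [:- a, 1:])" "length as = n"
    using char_poly_factorized[OF A] by auto
  have "a = 0" if "a \<in> set as" for a
  proof -
    have "a \<in> spectrum A" unfolding spectrum_root_char_poly[OF A] as(1)
      using linear_poly_root[OF that] by simp
    then show ?thesis using spectral_radius_mem_max(2)[OF A n, of "norm a"] assms(3) by auto
  qed
  then have "as = replicate n 0" using as(2) by (metis replicate_eqI)
  then show ?thesis unfolding as(1) by (simp add: poly_prod_list)
qed


section \<open>Effective spectrum and principal minors\<close>

lemma Diag_closed [simp]: "\<eta> \<in> carrier_vec n \<Longrightarrow> Diag \<eta> \<in> carrier_mat n n"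
  by (auto simp: Diag_def)

lemma poly_char_poly_mult_Diag:
  fixes K :: "real mat" and x :: complex
  assumes K: "K \<in> carrier_mat n n" and \<eta>: "\<eta> \<in> carrier_vec n"
  shows "poly (char_poly (map_mat complex_of_real (K * Diag \<eta>))) x
    = (\<Sum>S\<in>Pow {0..<n}. (-1) ^ card S * of_real (leibniz_minor K S * (\<Prod>i\<in>S. \<eta> $ i)) * x ^ (n - card S))"
proof -
  have "map_mat complex_of_real (K * Diag \<eta>) \<in> carrier_mat n n"
    using K \<eta> by (simp add: mult_carrier_mat[of _ n n])
  from poly_char_poly_eq_sum_minors[OF this, of x] show ?thesis
    by (simp add: leibniz_minor_mult_Diag[OF K \<eta>])
qed

lemma eff_spectrum_cong_minors:
  assumes K: "K \<in> carrier_mat n n" and K': "K' \<in> carrier_mat n n" and \<eta>: "\<eta> \<in> carrier_vec n"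
    and minors: "\<And>S. S \<subseteq> {0..<n} \<Longrightarrow> leibniz_minor K S = leibniz_minor K' S"
  shows "eff_spectrum K \<eta> = eff_spectrum K' \<eta>"
proof -
  have "map_mat complex_of_real (L * Diag \<eta>) \<in> carrier_mat n n" if "L \<in> carrier_mat n n" for L
    using that \<eta> by (simp add: mult_carrier_mat[of _ n n])
  then have "eff_spectrum L \<eta> = {x. poly (char_poly (map_mat complex_of_real (L * Diag \<eta>))) x = 0}"
    if "L \<in> carrier_mat n n" for L
    using that unfolding eff_spectrum_def by (simp add: spectrum_root_char_poly[of _ n] mult_carrier_mat[of _ n n] \<eta>)
  then show ?thesis
    using K K' \<eta> minors by (simp add: poly_char_poly_mult_Diag)
qed

lemma char_poly_root_eff_spectral_radius:
  fixes K :: "real mat"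
  assumes K: "K \<in> carrier_mat n n" and nonneg: "\<forall>i<n. \<forall>j<n. 0 \<le> K $$ (i, j)"
    and n: "n > 0" and \<eta>: "\<eta> \<in> nonneg_vecs n"
  shows "poly (char_poly (map_mat complex_of_real (K * Diag \<eta>))) (of_real (eff_spectral_radius K \<eta>)) = 0"
proof -
  have \<eta>': "\<eta> \<in> carrier_vec n" "\<forall>i<n. 0 \<le> \<eta> $ i" using \<eta> by (auto simp: nonneg_vecs_def)
  have KD: "K * Diag \<eta> \<in> carrier_mat n n" using K \<eta>' by (simp add: mult_carrier_mat[of _ n n])
  have "\<forall>i<n. \<forall>j<n. 0 \<le> (K * Diag \<eta>) $$ (i, j)"
    using \<eta>' nonneg K by (auto simp: Diag_def mat_diag_mult_right[OF K])
  from spectral_radius_in_spectrum_nonneg[OF KD this n] show ?thesis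
    unfolding eff_spectral_radius_def using KD
    by (subst (asm) spectrum_root_char_poly[of _ n]) auto
qed

text \<open>Induction on \<open>S\<close>: once the minors of the proper subsets agree, the characteristic polynomials at the
  indicator vector of \<open>S\<close> differ by a monomial with coefficient \<open>\<plusminus>\<close> the difference of
  the two minors in question. A point other than \<open>0\<close> where the two polynomials agree
  therefore proves the minors equal.\<close>

lemma leibniz_minor_eq_of_eff_spectral_radius_eq:
  fixes K K' :: "real mat"
  assumes n: "n > 0"
    and K: "K \<in> carrier_mat n n" and nonneg: "\<forall>i<n. \<forall>j<n. 0 \<le> K $$ (i, j)"
    and K': "K' \<in> carrier_mat n n" and nonneg': "\<forall>i<n. \<forall>j<n. 0 \<le> K' $$ (i, j)"
    and radius: "\<forall>\<eta>\<in>zero_one_vecs n. eff_spectral_radius K \<eta> = eff_spectral_radius K' \<eta>"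
    and S: "S \<subseteq> {0..<n}"
  shows "leibniz_minor K S = leibniz_minor K' S"
proof -
  have "finite S" using S finite_subset by blast
  then show ?thesis using S
  proof (induction S rule: finite_psubset_induct)
    case (psubset S)
    define \<eta> where "\<eta> = Matrix.vec n (\<lambda>i. if i \<in> S then 1 else 0 :: real)"
    define \<chi> where "\<chi> L = poly (char_poly (map_mat complex_of_real (L * Diag \<eta>)))" for L
    define r where "r = eff_spectral_radius K \<eta>"
    have \<eta>: "\<eta> \<in> carrier_vec n" "\<eta> \<in> nonneg_vecs n" "\<eta> \<in> zero_one_vecs n"
      by (auto simp: \<eta>_def nonneg_vecs_def zero_one_vecs_def)
    have r': "r = eff_spectral_radius K' \<eta>" using radius \<eta> by (simp add: r_def)
    have prod: "(\<Prod>i\<in>T. \<eta> $ i) = (if T \<subseteq> S then 1 else 0)" if T: "T \<subseteq> {0..<n}" for T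
    proof (cases "T \<subseteq> S")
      case True
      have "\<eta> $ i = 1" if "i \<in> T" for i
        using subsetD[OF T that] subsetD[OF True that] by (simp add: \<eta>_def)
      then show ?thesis using True by simp
    next
      case False
      then obtain i where "i \<in> T" "i \<notin> S" by auto
      moreover from this have "\<eta> $ i = 0" using subsetD[OF T, of i] by (simp add: \<eta>_def)
      moreover have "finite T" using T finite_subset by blast
      ultimately have "(\<Prod>i\<in>T. \<eta> $ i) = 0" by (metis prod_zero)
      then show ?thesis using False by simp
    qed
    have diff: "\<chi> K x - \<chi> K' x = (-1) ^ card S * of_real (leibniz_minor K S - leibniz_minor K' S) * x ^ (n - card S)" for x
    proof -
      have "\<chi> K x - \<chi> K' x = (\<Sum>T\<in>Pow {0..<n}. (-1) ^ card T *
          of_real ((leibniz_minor K T - leibniz_minor K' T) * (\<Prod>i\<in>T. \<eta> $ i)) * x ^ (n - card T))"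
        unfolding \<chi>_def poly_char_poly_mult_Diag[OF K \<eta>(1)] poly_char_poly_mult_Diag[OF K' \<eta>(1)]
          sum_subtractf[symmetric]
        by (intro sum.cong refl) (simp only: left_diff_distrib right_diff_distrib of_real_diff)
      also have "\<dots> = (\<Sum>T\<in>{S}. (-1) ^ card T *
          of_real ((leibniz_minor K T - leibniz_minor K' T) * (\<Prod>i\<in>T. \<eta> $ i)) * x ^ (n - card T))"
      proof (rule sum.mono_neutral_right)
        show "\<forall>T\<in>Pow {0..<n} - {S}. (-1) ^ card T *
          of_real ((leibniz_minor K T - leibniz_minor K' T) * (\<Prod>i\<in>T. \<eta> $ i)) * x ^ (n - card T) = 0"
        proof
          fix T assume T: "T \<in> Pow {0..<n} - {S}"
          show "(-1) ^ card T * of_real ((leibniz_minor K T - leibniz_minor K' T) * (\<Prod>i\<in>T. \<eta> $ i)) * x ^ (n - card T) = 0"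
          proof (cases "T \<subseteq> S")
            case True
            then have "leibniz_minor K T = leibniz_minor K' T" using T psubset.IH[of T] by auto
            then show ?thesis by simp
          next
            case False
            then show ?thesis using T prod[of T] by simp
          qed
        qed
      qed (use psubset.prems in auto)
      finally show ?thesis using prod[OF psubset.prems] by simp
    qed
    \<comment> \<open>A vanishing common radius gives no information, but then both polynomials are \<open>x^n\<close> and
      agree at any nonzero point.\<close>
    show ?case
    proof (cases "r = 0")
      case True
      have "\<chi> L 1 = 1" if "L \<in> carrier_mat n n" "eff_spectral_radius L \<eta> = 0" for L
        unfolding \<chi>_def
        using char_poly_of_spectral_radius_0[OF _ n, of "map_mat complex_of_real (L * Diag \<eta>)" 1] that \<eta>
        by (simp add: eff_spectral_radius_def mult_carrier_mat[of _ n n])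
      then have "\<chi> K 1 - \<chi> K' 1 = 0" using K K' True r' by (simp add: r_def)
      then show ?thesis unfolding diff by (simp flip: of_real_diff)
    next
      case False
      have "\<chi> K (of_real r) - \<chi> K' (of_real r) = 0"
        unfolding \<chi>_def using char_poly_root_eff_spectral_radius[OF K nonneg n \<eta>(2)]
          char_poly_root_eff_spectral_radius[OF K' nonneg' n \<eta>(2)]
        by (simp add: r_def[symmetric] r'[symmetric])
      then show ?thesis unfolding diff using False by (simp flip: of_real_diff)
    qed
  qed
qed

theorem theorem2p1:
  fixes n :: nat and K K' :: "real mat"
  assumes "1 \<le> n"
    and "K \<in> carrier_mat n n" and "\<forall>i<n. \<forall>j<n. 0 \<le> K $$ (i, j)"
    and "K' \<in> carrier_mat n n" and "\<forall>i<n. \<forall>j<n. 0 \<le> K' $$ (i, j)"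
  shows
    "let i = (\<forall>\<eta>\<in>nonneg_vecs n. eff_spectral_radius K \<eta> = eff_spectral_radius K' \<eta>);
         ii = (\<forall>\<eta>\<in>zero_one_vecs n. eff_spectral_radius K \<eta> = eff_spectral_radius K' \<eta>);
         iii = (\<forall>\<eta>\<in>nonneg_vecs n. eff_spectrum K \<eta> = eff_spectrum K' \<eta>);
         iv = (\<forall>\<eta>\<in>zero_one_vecs n. eff_spectrum K \<eta> = eff_spectrum K' \<eta>);
         v = (\<forall>\<alpha>. \<alpha> \<subseteq> {0..<n} \<and> \<alpha> \<noteq> {} \<longrightarrow> principal_minor K \<alpha> = principal_minor K' \<alpha>)
     in (i \<longleftrightarrow> ii) \<and> (i \<longleftrightarrow> iii) \<and> (i \<longleftrightarrow> iv) \<and> (i \<longleftrightarrow> v)"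
proof -
  have sub: "zero_one_vecs n \<subseteq> nonneg_vecs n"
    by (force simp: zero_one_vecs_def nonneg_vecs_def)
  have carrier: "nonneg_vecs n \<subseteq> carrier_vec n" by (auto simp: nonneg_vecs_def)
  have radius: "eff_spectral_radius K \<eta> = eff_spectral_radius K' \<eta>"
    if "eff_spectrum K \<eta> = eff_spectrum K' \<eta>" for \<eta>
    using that by (simp add: eff_spectral_radius_def eff_spectrum_def spectral_radius_def)
  have minor: "principal_minor L S = leibniz_minor L S"
    if "L \<in> carrier_mat n n" "S \<subseteq> {0..<n}" for L S
    using det_principal_submatrix[OF that] by (simp add: principal_minor_def)
  have v: "principal_minor K S = principal_minor K' S"
    if "\<forall>\<eta>\<in>zero_one_vecs n. eff_spectral_radius K \<eta> = eff_spectral_radius K' \<eta>" "S \<subseteq> {0..<n}" for S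
    using leibniz_minor_eq_of_eff_spectral_radius_eq[OF _ assms(2-5) that] assms(1,2,4) that(2)
    by (simp add: minor)
  have iii: "eff_spectrum K \<eta> = eff_spectrum K' \<eta>"
    if minors: "\<forall>\<alpha>. \<alpha> \<subseteq> {0..<n} \<and> \<alpha> \<noteq> {} \<longrightarrow> principal_minor K \<alpha> = principal_minor K' \<alpha>"
      and \<eta>: "\<eta> \<in> nonneg_vecs n" for \<eta>
  proof (rule eff_spectrum_cong_minors)
    show "leibniz_minor K S = leibniz_minor K' S" if "S \<subseteq> {0..<n}" for S
    proof (cases "S = {}")
      case True
      \<comment> \<open>The expansion contains the empty minor, which is 1 for every matrix.\<close>
      then show ?thesis by (simp add: leibniz_minor_def)
    next
      case False
      then show ?thesis using minors that minor[OF assms(2) that] minor[OF assms(4) that] by auto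
    qed
  qed (use assms \<eta> carrier in auto)
  show ?thesis unfolding Let_def
    using sub radius v iii by (intro conjI iffI ballI allI impI) (metis subsetD)+
qed

end
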